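(* Let $\Omega\subset\mathbb{R}^d$ be a bounded $C^{2,1}$ domain and let $\{T_t\}$ be a twice differentiable family of deformations of $\Omega$. Let $\chi$ and $\sigma$ be the functions on $\partial\Omega$ given by $$\chi=[R-(S\cdot\nabla)S]\cdot\boldsymbol{\nu}-(\delta\rho)^2\,\nabla\cdot\boldsymbol{\nu}-(S\cdot\nabla)\delta\rho+\frac{\partial(\delta\rho)^2}{\partial\boldsymbol{\nu}},$$ $$\sigma=[R-(S\cdot\nabla)S]\cdot\boldsymbol{\nu}+\delta\rho\frac{\partial\delta\rho}{\partial\boldsymbol{\nu}}-(S_\tau\cdot\nabla_\tau)\delta\rho.$$ Then $$\chi=\delta^2\rho-2(S_\tau\cdot\nabla_\tau)\delta\rho-\mathcal{B}(S_\tau,S_\tau)-(\delta\rho)^2(\nabla\cdot\boldsymbol{\nu}),\qquad\sigma=\delta^2\rho-2(S_\tau\cdot\nabla_\tau)\delta\rho-\mathcal{B}(S_\tau,S_\tau),$$ where $\mathcal{B}$ is the second fundamental form on $\partial\Omega$.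
   Context: $d\ge 2$. $T_t:\Omega\to\Omega_t=T_t(\Omega)$, $|t|\ll1$, is a family of bi-Lipschitz homeomorphisms with $T_0=I$, $DT_t$ its Jacobi matrix. It is twice differentiable if $T_tx$ is twice continuously differentiable in $t$ for every $x\in\Omega$ and the (matrix-valued) mappings $\frac{\partial^2}{\partial t^2}DT_t$, $\frac{\partial^2}{\partial t^2}(DT_t)^{-1}$ on $\Omega$ are uniformly bounded. $S=\frac{\partial T_t}{\partial t}|_{t=0}$ and $R=\frac{\partial^2T_t}{\partial t^2}|_{t=0}$ are Lipschitz vector fields on $\overline\Omega$. $\boldsymbol{\nu}$ is the unit outer normal on $\partial\Omega$, extended near $\partial\Omega$ as a unit vector field constant along normals ($\partial\boldsymbol{\nu}/\partial\boldsymbol{\nu}=0$); $\delta\rho=S\cdot\boldsymbol{\nu}$, $\delta^2\rho=R\cdot\boldsymbol{\nu}$, $S_\tau=S-(\delta\rho)\boldsymbol{\nu}$, and $\nabla_\tau$ is the tangential gradient on $\partial\Omega$. The second fundamental form is $\mathcal{B}[\xi,\eta]=-\frac{\partial\boldsymbol{\nu}}{\partial\xi}\cdot\eta=-(\nabla\boldsymbol{\nu})[\xi,\eta]$. Identities hold almost everywhere on $\partial\Omega$. ($\chi$ and $\sigma$ are the weights appearing in the paper's second variational formula for the Green's function, on the Dirichlet part and the Neumann part of $\partial\Omega$ respectively.)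
   Formalization: The identities are stated at every boundary point where S is differentiable (relative to the closure of Ω); for a merely Lipschitz S the derivatives of S and δρ in χ and σ may exist nowhere on ∂Ω, so the a.e. claim is otherwise undefined. *)

theory Defs
  imports "HOL-Analysis.Analysis"
begin

section \<open>Domains of class \<open>C\<^sup>2\<^sup>,\<^sup>1\<close>\<close>

definition C21_on :: "(real^'n) set \<Rightarrow> (real^'n \<Rightarrow> real) \<Rightarrow> bool" where
  "C21_on U \<phi> \<longleftrightarrow>
     (\<exists>(\<phi>' :: real^'n \<Rightarrow> ((real^'n) \<Rightarrow>\<^sub>L real))
       (\<phi>'' :: real^'n \<Rightarrow> ((real^'n) \<Rightarrow>\<^sub>L ((real^'n) \<Rightarrow>\<^sub>L real))) L.
        (\<forall>x\<in>U. (\<phi> has_derivative blinfun_apply (\<phi>' x)) (at x) \<and>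
                (\<phi>' has_derivative blinfun_apply (\<phi>'' x)) (at x)) \<and>
        L-lipschitz_on U \<phi>'')"

text \<open>Near each boundary point, the domain is the part below the graph, in some unit direction
  \<open>e\<close>, of a \<open>C\<^sup>2\<^sup>,\<^sup>1\<close> function of the component orthogonal to \<open>e\<close>; such a function is represented by
  a function on the whole space that is invariant under translations along \<open>e\<close>.\<close>

definition C21_domain :: "(real^'n) set \<Rightarrow> bool" where
  "C21_domain \<Omega> \<longleftrightarrow> open \<Omega> \<and> connected \<Omega> \<and> \<Omega> \<noteq> {} \<and>
     (\<forall>p\<in>frontier \<Omega>. \<exists>e r \<phi>. norm e = 1 \<and> r > 0 \<and>
        (\<forall>x s. \<phi> (x + s *\<^sub>R e) = \<phi> x) \<and> C21_on (ball p r) \<phi> \<and>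
        \<Omega> \<inter> ball p r = {x \<in> ball p r. x \<bullet> e < \<phi> x})"

section \<open>Families of deformations\<close>

definition bi_lipschitz_homeo_on :: "(real^'n) set \<Rightarrow> (real^'n \<Rightarrow> real^'n) \<Rightarrow> bool" where
  "bi_lipschitz_homeo_on \<Omega> f \<longleftrightarrow>
     (\<exists>g C C'. homeomorphism \<Omega> (f ` \<Omega>) f g \<and> C-lipschitz_on \<Omega> f \<and> C'-lipschitz_on (f ` \<Omega>) g)"

definition deformation_family :: "(real^'n) set \<Rightarrow> real \<Rightarrow> (real \<Rightarrow> real^'n \<Rightarrow> real^'n) \<Rightarrow> bool" where
  "deformation_family \<Omega> \<epsilon> T \<longleftrightarrow> \<epsilon> > 0 \<and>
     (\<forall>t\<in>{-\<epsilon><..<\<epsilon>}. bi_lipschitz_homeo_on \<Omega> (T t)) \<and> (\<forall>x\<in>\<Omega>. T 0 x = x)"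

definition second_deriv_on ::
    "real set \<Rightarrow> (real \<Rightarrow> 'a::real_normed_vector) \<Rightarrow> (real \<Rightarrow> 'a) \<Rightarrow> bool" where
  "second_deriv_on I g g'' \<longleftrightarrow>
     (\<exists>g'. \<forall>t\<in>I. (g has_vector_derivative g' t) (at t) \<and> (g' has_vector_derivative g'' t) (at t))"

text \<open>The Jacobi matrix of a Lipschitz map exists only almost everywhere, hence the null set \<open>N\<close>.
  Where the Jacobi matrix of a bi-Lipschitz map on an open set exists, it is invertible, so that
  \<open>matrix_inv\<close> is the genuine inverse.\<close>

definition twice_differentiable_family ::
    "(real^'n) set \<Rightarrow> real \<Rightarrow> (real \<Rightarrow> real^'n \<Rightarrow> real^'n) \<Rightarrow> bool" where
  "twice_differentiable_family \<Omega> \<epsilon> T \<longleftrightarrow>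
     (\<forall>x\<in>\<Omega>. \<exists>g''. second_deriv_on {-\<epsilon><..<\<epsilon>} (\<lambda>t. T t x) g'' \<and>
                    continuous_on {-\<epsilon><..<\<epsilon>} g'') \<and>
     (\<exists>N M. negligible N \<and> (\<forall>x\<in>\<Omega> - N.
        (\<forall>t\<in>{-\<epsilon><..<\<epsilon>}. T t differentiable (at x)) \<and>
        (\<exists>J''. second_deriv_on {-\<epsilon><..<\<epsilon>} (\<lambda>t. jacobian (T t) (at x)) J'' \<and>
               (\<forall>t\<in>{-\<epsilon><..<\<epsilon>}. norm (J'' t) \<le> M)) \<and>
        (\<exists>K''. second_deriv_on {-\<epsilon><..<\<epsilon>} (\<lambda>t. matrix_inv (jacobian (T t) (at x))) K'' \<and>
               (\<forall>t\<in>{-\<epsilon><..<\<epsilon>}. norm (K'' t) \<le> M))))"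

text \<open>On the boundary the fields are determined by continuity.\<close>

definition velocity_field ::
    "(real^'n) set \<Rightarrow> (real \<Rightarrow> real^'n \<Rightarrow> real^'n) \<Rightarrow> (real^'n \<Rightarrow> real^'n) \<Rightarrow> bool" where
  "velocity_field \<Omega> T S \<longleftrightarrow> (\<exists>L. L-lipschitz_on (closure \<Omega>) S) \<and>
     (\<forall>x\<in>\<Omega>. S x = vector_derivative (\<lambda>t. T t x) (at 0))"

definition acceleration_field ::
    "(real^'n) set \<Rightarrow> (real \<Rightarrow> real^'n \<Rightarrow> real^'n) \<Rightarrow> (real^'n \<Rightarrow> real^'n) \<Rightarrow> bool" where
  "acceleration_field \<Omega> T R \<longleftrightarrow> (\<exists>L. L-lipschitz_on (closure \<Omega>) R) \<and>
     (\<forall>x\<in>\<Omega>. R x = vector_derivative (\<lambda>t. vector_derivative (\<lambda>u. T u x) (at t)) (at 0))"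

section \<open>Geometry of the boundary\<close>

definition outer_unit_normal :: "(real^'n) set \<Rightarrow> real^'n \<Rightarrow> real^'n \<Rightarrow> bool" where
  "outer_unit_normal \<Omega> x n \<longleftrightarrow> norm n = 1 \<and>
     ((\<lambda>y. ((y - x) \<bullet> n) / norm (y - x)) \<longlongrightarrow> 0) (at x within frontier \<Omega>) \<and>
     (\<forall>\<^sub>F s in at_right (0::real). x + s *\<^sub>R n \<notin> closure \<Omega>)"

text \<open>The outer unit normal, extended to a neighbourhood of the boundary so as to be constant
  along normals.\<close>

definition extended_normal :: "(real^'n) set \<Rightarrow> (real^'n \<Rightarrow> real^'n) \<Rightarrow> bool" where
  "extended_normal \<Omega> \<nu> \<longleftrightarrow>
     (\<forall>x\<in>frontier \<Omega>. outer_unit_normal \<Omega> x (\<nu> x)) \<and>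
     (\<exists>\<delta>>0. \<forall>x\<in>frontier \<Omega>. \<forall>s. \<bar>s\<bar> < \<delta> \<longrightarrow> \<nu> (x + s *\<^sub>R \<nu> x) = \<nu> x)"

definition divergence :: "(real^'n \<Rightarrow> real^'n) \<Rightarrow> real^'n \<Rightarrow> real" where
  "divergence X x = trace (jacobian X (at x))"

definition second_fundamental_form ::
    "(real^'n \<Rightarrow> real^'n) \<Rightarrow> real^'n \<Rightarrow> real^'n \<Rightarrow> real^'n \<Rightarrow> real" where
  "second_fundamental_form \<nu> x \<xi> \<eta> = - (frechet_derivative \<nu> (at x) \<xi> \<bullet> \<eta>)"

text \<open>Only the values of \<open>f\<close> on the boundary enter the tangential gradient.\<close>

definition tangential_gradient ::
    "(real^'n) set \<Rightarrow> (real^'n \<Rightarrow> real^'n) \<Rightarrow> (real^'n \<Rightarrow> real) \<Rightarrow> real^'n \<Rightarrow> real^'n" where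
  "tangential_gradient \<Omega> \<nu> f x =
     (THE g. g \<bullet> \<nu> x = 0 \<and> (f has_derivative (\<lambda>v. g \<bullet> v)) (at x within frontier \<Omega>))"

text \<open>The derivative of \<open>f\<close> at \<open>x\<close> in direction \<open>v\<close> for functions given on the closed domain,
  including boundary points \<open>x\<close>.\<close>

definition dir_deriv ::
    "(real^'n) set \<Rightarrow> (real^'n \<Rightarrow> 'b::real_normed_vector) \<Rightarrow> real^'n \<Rightarrow> real^'n \<Rightarrow> 'b" where
  "dir_deriv \<Omega> f v x = frechet_derivative f (at x within closure \<Omega>) v"

section \<open>The boundary weights\<close>

definition normal_part :: "(real^'n \<Rightarrow> real^'n) \<Rightarrow> (real^'n \<Rightarrow> real^'n) \<Rightarrow> real^'n \<Rightarrow> real" where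
  "normal_part \<nu> X x = X x \<bullet> \<nu> x"

definition tangential_part ::
    "(real^'n \<Rightarrow> real^'n) \<Rightarrow> (real^'n \<Rightarrow> real^'n) \<Rightarrow> real^'n \<Rightarrow> real^'n" where
  "tangential_part \<nu> X x = X x - normal_part \<nu> X x *\<^sub>R \<nu> x"

definition chi_weight ::
    "(real^'n) set \<Rightarrow> (real^'n \<Rightarrow> real^'n) \<Rightarrow> (real^'n \<Rightarrow> real^'n) \<Rightarrow> (real^'n \<Rightarrow> real^'n) \<Rightarrow>
      real^'n \<Rightarrow> real" where
  "chi_weight \<Omega> \<nu> S R x =
     (let \<delta>\<rho> = normal_part \<nu> S in
      (R x - dir_deriv \<Omega> S (S x) x) \<bullet> \<nu> x
      - (\<delta>\<rho> x)\<^sup>2 * divergence \<nu> x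
      - dir_deriv \<Omega> \<delta>\<rho> (S x) x
      + dir_deriv \<Omega> (\<lambda>y. (\<delta>\<rho> y)\<^sup>2) (\<nu> x) x)"

definition sigma_weight ::
    "(real^'n) set \<Rightarrow> (real^'n \<Rightarrow> real^'n) \<Rightarrow> (real^'n \<Rightarrow> real^'n) \<Rightarrow> (real^'n \<Rightarrow> real^'n) \<Rightarrow>
      real^'n \<Rightarrow> real" where
  "sigma_weight \<Omega> \<nu> S R x =
     (let \<delta>\<rho> = normal_part \<nu> S in
      (R x - dir_deriv \<Omega> S (S x) x) \<bullet> \<nu> x
      + \<delta>\<rho> x * dir_deriv \<Omega> \<delta>\<rho> (\<nu> x) x
      - tangential_part \<nu> S x \<bullet> tangential_gradient \<Omega> \<nu> \<delta>\<rho> x)"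

end

theory Submission
  imports Defs
begin

text \<open>
  Write \<open>\<delta>\<rho> = S \<bullet> \<nu>\<close>, let \<open>D\<close> be the derivative of \<open>S\<close> and \<open>N\<close> the derivative of \<open>\<nu>\<close> at a boundary
  point. The product rule gives \<open>\<partial>\<^sub>S \<delta>\<rho> = D S \<bullet> \<nu> + S \<bullet> N S\<close>. Since \<open>\<nu>\<close> is constant along normals,
  \<open>N \<nu> = 0\<close>; since it is a unit field, \<open>N\<close> takes tangential values. Hence
  \<open>S \<bullet> N S = S\<^sub>\<tau> \<bullet> N S\<^sub>\<tau> = - \<B>(S\<^sub>\<tau>, S\<^sub>\<tau>)\<close>, so that \<open>(S \<cdot> \<nabla>)S \<bullet> \<nu> = \<partial>\<^sub>S \<delta>\<rho> + \<B>(S\<^sub>\<tau>, S\<^sub>\<tau>)\<close>. Substituting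
  this and splitting \<open>\<partial>\<^sub>S \<delta>\<rho> = S\<^sub>\<tau> \<bullet> \<nabla>\<^sub>\<tau> \<delta>\<rho> + \<delta>\<rho> \<partial>\<^sub>\<nu> \<delta>\<rho>\<close> makes all normal derivatives cancel, in both
  weights.

  The substance of the proof is that these derivatives exist and are unambiguous.

  The field \<open>\<nu>\<close> is prescribed only through its values on the boundary, which are those of
  the normalized gradient \<open>\<nabla>F / |\<nabla>F|\<close> of a local defining function \<open>F\<close> (\<open>outer_unit_normal_eq\<close>),
  and its constancy along normals. With \<open>\<pi>\<close> a projection onto the boundary along the graph
  direction and \<open>m = (\<nabla>F / |\<nabla>F|) \<circ> \<pi>\<close>, this means \<open>\<nu> (\<Phi> y) = m y\<close> for \<open>\<Phi> = \<pi> + F m\<close>. The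
  derivative of \<open>\<Phi>\<close> at the boundary point is injective, so \<open>\<Phi>\<close> is locally open there and the
  differentiability of \<open>m\<close> carries over to \<open>\<nu>\<close> (\<open>has_derivative_factor\<close>,
  \<open>extended_normal_differentiable\<close>).

  Derivatives within \<open>closure \<Omega>\<close> and within \<open>frontier \<Omega>\<close> are determined on the velocities of curves
  that stay in these sets (\<open>has_derivative_unique_along_curve\<close>). In the closed domain these
  velocities fill an open half-space, which spans; in the boundary they fill the tangent
  hyperplane.
\<close>

section \<open>Derivatives within a set and along curves\<close>

lemma has_derivative_unique_along_curve:
  assumes A: "(f has_derivative A) (at x within X)"
    and B: "(f has_derivative B) (at x within X)"
    and c: "(c has_vector_derivative w) (at 0 within {0..d})" "c 0 = x"
    and d: "d > 0" and sub: "\<And>s. s \<in> {0..d} \<Longrightarrow> c s \<in> X"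
  shows "A w = B w"
proof -
  have img: "c ` {0..d} \<subseteq> X"
    using sub by blast
  have "((f \<circ> c) has_vector_derivative A w) (at 0 within {0..d})"
    by (rule vector_derivative_diff_chain_within[OF c(1)])
       (use has_derivative_subset[OF A img] c(2) in simp)
  moreover have "((f \<circ> c) has_vector_derivative B w) (at 0 within {0..d})"
    by (rule vector_derivative_diff_chain_within[OF c(1)])
       (use has_derivative_subset[OF B img] c(2) in simp)
  ultimately show ?thesis
    using vector_derivative_unique_within_closed_interval[of 0 d 0 "f \<circ> c"] d by auto
qed

lemma has_derivative_unique_along_ray:
  assumes "(f has_derivative A) (at x within X)" and "(f has_derivative B) (at x within X)"
    and "d > 0" and "\<And>s. s \<in> {0..d} \<Longrightarrow> x + s *\<^sub>R w \<in> X"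
  shows "A w = B w"
proof (rule has_derivative_unique_along_curve[OF assms(1,2)])
  show "((\<lambda>s. x + s *\<^sub>R w) has_vector_derivative w) (at 0 within {0..d})"
    by (auto intro!: derivative_eq_intros)
qed (use assms in auto)

lemma linear_functional_inner:
  fixes A :: "'a::euclidean_space \<Rightarrow> real"
  assumes "linear A"
  shows "(\<Sum>b\<in>Basis. A b *\<^sub>R b) \<bullet> v = A v"
proof -
  interpret A: linear A
    by (fact assms)
  have "A v = A (\<Sum>b\<in>Basis. (v \<bullet> b) *\<^sub>R b)"
    by (simp only: euclidean_representation)
  also have "\<dots> = (\<Sum>b\<in>Basis. (v \<bullet> b) * A b)"
    by (simp only: A.sum A.scaleR real_scaleR_def)
  finally show ?thesis
    by (simp add: inner_sum_left inner_commute[of v] mult.commute)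
qed

text \<open>Here \<open>h\<close> is given implicitly by \<open>h \<circ> f = m\<close>, through preimages of nearby points that can be
  taken as close to \<open>x\<close> as desired. Injectivity of \<open>f'\<close> then bounds \<open>y - x\<close> by
  a multiple of \<open>f y - f x\<close>, so errors of first order in \<open>y - x\<close> are errors of first order
  in \<open>f y - f x\<close>.\<close>

lemma has_derivative_factor:
  fixes f :: "'a::euclidean_space \<Rightarrow> 'a" and m :: "'a \<Rightarrow> 'b::real_normed_vector"
  assumes f: "(f has_derivative f') (at x)" and m: "(m has_derivative M) (at x)"
    and g': "bounded_linear g'" and inv: "\<And>v. g' (f' v) = v"
    and hx: "h (f x) = m x"
    and near: "\<And>d. d > 0 \<Longrightarrow> \<forall>\<^sub>F z in nhds (f x). \<exists>y\<in>ball x d. f y = z \<and> h z = m y"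
  shows "(h has_derivative (M \<circ> g')) (at (f x))"
  unfolding has_derivative_at_alt
proof (intro conjI allI impI)
  interpret M: bounded_linear M
    using m has_derivative_bounded_linear by blast
  interpret g': bounded_linear g'
    by (fact g')
  show "bounded_linear (M \<circ> g')"
    using bounded_linear_compose[OF M.bounded_linear_axioms g'] by (simp add: o_def)
  obtain K where K: "K > 0" "\<And>w. norm (g' w) \<le> K * norm w"
    using g'.pos_bounded by (auto simp: mult.commute)
  obtain B where B: "B > 0" "\<And>w. norm (M w) \<le> B * norm w"
    using M.pos_bounded by (auto simp: mult.commute)
  fix e :: real assume e: "e > 0"
  \<comment> \<open>The first bound on \<open>\<epsilon>\<close> lets the linear part of \<open>f\<close> dominate its error; the second one is what
    the final estimate requires.\<close>
  define \<epsilon> where "\<epsilon> = min (1 / (2 * K)) (e / ((1 + B * K) * (2 * K)))"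
  have pos: "(1 + B * K) * (2 * K) > 0"
    using B K by (simp add: add_pos_pos)
  have \<epsilon>: "\<epsilon> > 0" "K * \<epsilon> \<le> 1 / 2" "\<epsilon> * ((1 + B * K) * (2 * K)) \<le> e"
  proof -
    show "\<epsilon> > 0"
      using K e pos by (simp add: \<epsilon>_def)
    have "\<epsilon> \<le> 1 / (2 * K)"
      by (simp add: \<epsilon>_def)
    then show "K * \<epsilon> \<le> 1 / 2"
      using K by (simp add: field_simps)
    have "\<epsilon> \<le> e / ((1 + B * K) * (2 * K))"
      by (simp add: \<epsilon>_def)
    then show "\<epsilon> * ((1 + B * K) * (2 * K)) \<le> e"
      using pos by (simp add: pos_le_divide_eq)
  qed
  obtain d1 where d1: "d1 > 0"
    "\<And>y. norm (y - x) < d1 \<Longrightarrow> norm (f y - f x - f' (y - x)) \<le> \<epsilon> * norm (y - x)"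
    using f \<epsilon>(1) unfolding has_derivative_at_alt by blast
  obtain d2 where d2: "d2 > 0"
    "\<And>y. norm (y - x) < d2 \<Longrightarrow> norm (m y - m x - M (y - x)) \<le> \<epsilon> * norm (y - x)"
    using m \<epsilon>(1) unfolding has_derivative_at_alt by blast
  have "\<forall>\<^sub>F z in nhds (f x). \<exists>y\<in>ball x (min d1 d2). f y = z \<and> h z = m y"
    using near d1(1) d2(1) by simp
  then obtain d where d: "d > 0"
    "\<And>z. dist z (f x) < d \<Longrightarrow> \<exists>y\<in>ball x (min d1 d2). f y = z \<and> h z = m y"
    unfolding eventually_nhds_metric by blast
  have "norm (h z - h (f x) - (M \<circ> g') (z - f x)) \<le> e * norm (z - f x)"
    if z: "norm (z - f x) < d" for z
  proof -
    obtain y where y: "norm (y - x) < d1" "norm (y - x) < d2" "f y = z" "h z = m y"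
      using d(2)[of z] z by (auto simp: dist_norm norm_minus_commute[of x])
    have diff: "g' (z - f x) - (y - x) = g' (f y - f x - f' (y - x))"
      by (simp add: g'.diff inv y(3))
    have err: "norm (g' (z - f x) - (y - x)) \<le> K * \<epsilon> * norm (y - x)"
      unfolding diff using K(2)[of "f y - f x - f' (y - x)"] d1(2)[OF y(1)] K(1)
      by (smt (verit, best) mult.assoc mult_left_mono)
    also have "\<dots> \<le> 1 / 2 * norm (y - x)"
      using \<epsilon>(2) by (intro mult_right_mono) auto
    finally have "norm (y - x) \<le> 2 * norm (g' (z - f x))"
      using norm_triangle_ineq2[of "y - x" "g' (z - f x)"] by (simp add: norm_minus_commute)
    then have size: "norm (y - x) \<le> 2 * K * norm (z - f x)"
      using K(2)[of "z - f x"] by simp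
    have "h z - h (f x) - (M \<circ> g') (z - f x)
        = (m y - m x - M (y - x)) - M (g' (z - f x) - (y - x))"
      by (simp add: y(4) hx M.diff)
    also have "norm \<dots> \<le> norm (m y - m x - M (y - x)) + norm (M (g' (z - f x) - (y - x)))"
      by (rule norm_triangle_ineq4)
    also have "\<dots> \<le> \<epsilon> * norm (y - x) + B * (K * \<epsilon> * norm (y - x))"
      by (intro add_mono d2(2) y order_trans[OF B(2)] mult_left_mono err) (use B in auto)
    also have "\<dots> = \<epsilon> * (1 + B * K) * norm (y - x)"
      by (simp add: algebra_simps)
    also have "\<dots> \<le> \<epsilon> * (1 + B * K) * (2 * K * norm (z - f x))"
      using \<epsilon>(1) B K size by (intro mult_left_mono) auto
    also have "\<dots> = \<epsilon> * ((1 + B * K) * (2 * K)) * norm (z - f x)"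
      by (simp add: algebra_simps)
    also have "\<dots> \<le> e * norm (z - f x)"
      using \<epsilon>(3) by (intro mult_right_mono) auto
    finally show ?thesis .
  qed
  then show "\<exists>d>0. \<forall>z. norm (z - f x) < d \<longrightarrow>
      norm (h z - h (f x) - (M \<circ> g') (z - f x)) \<le> e * norm (z - f x)"
    using d(1) by blast
qed

section \<open>Local defining functions of the domain\<close>

text \<open>In the ball, \<open>F\<close> is a defining function of the domain that is affine along the graph
  direction \<open>e\<close>, and \<open>G\<close> is its gradient. Affinity makes the projection \<open>y - F y e\<close> onto the
  boundary explicit; differentiability of \<open>G\<close> is what will make the normal field differentiable.\<close>

locale boundary_chart =
  fixes \<Omega> :: "(real^'n) set" and p :: "real^'n" and r :: real and e :: "real^'n"
    and F :: "real^'n \<Rightarrow> real" and G :: "real^'n \<Rightarrow> real^'n"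
  assumes open_domain: "open \<Omega>" and p_frontier: "p \<in> frontier \<Omega>" and r_pos: "r > 0"
    and F_shift: "F (y + s *\<^sub>R e) = F y + s"
    and F_deriv: "y \<in> ball p r \<Longrightarrow> (F has_derivative (\<lambda>v. G y \<bullet> v)) (at y)"
    and G_diff: "y \<in> ball p r \<Longrightarrow> G differentiable (at y)"
    and domain_iff: "y \<in> ball p r \<Longrightarrow> y \<in> \<Omega> \<longleftrightarrow> F y < 0"

lemma C21_domain_chart:
  fixes \<Omega> :: "(real^'n) set"
  assumes "C21_domain \<Omega>" and p: "p \<in> frontier \<Omega>"
  obtains r e F G where "boundary_chart \<Omega> p r e F G"
proof -
  obtain e r \<phi> where e: "norm e = 1" and r: "r > 0"
    and shift: "\<And>x s. \<phi> (x + s *\<^sub>R e) = \<phi> x" and C: "C21_on (ball p r) \<phi>"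
    and graph: "\<Omega> \<inter> ball p r = {x \<in> ball p r. x \<bullet> e < \<phi> x}"
    using assms(1)[unfolded C21_domain_def] p by blast
  obtain \<phi>' :: "real^'n \<Rightarrow> ((real^'n) \<Rightarrow>\<^sub>L real)" and \<phi>'' where
    \<phi>': "\<And>x. x \<in> ball p r \<Longrightarrow> (\<phi> has_derivative blinfun_apply (\<phi>' x)) (at x)" and
    \<phi>'': "\<And>x. x \<in> ball p r \<Longrightarrow> (\<phi>' has_derivative blinfun_apply (\<phi>'' x)) (at x)"
    using C unfolding C21_on_def by blast
  define G where "G y = e - (\<Sum>b\<in>Basis. blinfun_apply (\<phi>' y) b *\<^sub>R b)" for y
  have G_inner: "G y \<bullet> v = v \<bullet> e - blinfun_apply (\<phi>' y) v" for y v
    using linear_functional_inner[OF bounded_linear.linear[OF blinfun.bounded_linear_right], of "\<phi>' y" v]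
    by (simp add: G_def inner_diff_left inner_commute[of e])
  have "boundary_chart \<Omega> p r e (\<lambda>y. y \<bullet> e - \<phi> y) G"
  proof
    show "open \<Omega>"
      using assms(1) by (simp add: C21_domain_def)
    show "(y + s *\<^sub>R e) \<bullet> e - \<phi> (y + s *\<^sub>R e) = y \<bullet> e - \<phi> y + s" for y s
      using e by (simp add: shift inner_add_left dot_square_norm)
    show "((\<lambda>y. y \<bullet> e - \<phi> y) has_derivative (\<lambda>v. G y \<bullet> v)) (at y)" if "y \<in> ball p r" for y
      unfolding G_inner by (intro derivative_intros \<phi>' that)
    show "G differentiable (at y)" if "y \<in> ball p r" for y
    proof -
      have "\<phi>' differentiable (at y)"
        using \<phi>''[OF that] by (rule differentiableI)
      then have "(\<lambda>y. blinfun_apply (\<phi>' y) b) differentiable (at y)" for b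
        using bounded_linear.has_derivative[OF blinfun.bounded_linear_left]
        unfolding differentiable_def by blast
      then show ?thesis
        unfolding G_def [abs_def] by (intro derivative_intros) auto
    qed
    show "y \<in> \<Omega> \<longleftrightarrow> y \<bullet> e - \<phi> y < 0" if "y \<in> ball p r" for y
    proof -
      have "y \<in> \<Omega> \<inter> ball p r \<longleftrightarrow> y \<in> {x \<in> ball p r. x \<bullet> e < \<phi> x}"
        by (simp only: graph)
      then show ?thesis
        using that by simp
    qed
  qed (fact p, fact r)
  then show thesis
    by (rule that)
qed

text \<open>The tangency condition on an outer normal, read as a derivative so that it can be compared
  with other derivatives along boundary curves.\<close>

lemma outer_unit_normal_flat:
  assumes "outer_unit_normal \<Omega> y n"
  shows "((\<lambda>z. z \<bullet> n) has_derivative (\<lambda>v. 0)) (at y within frontier \<Omega>)"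
proof -
  have "((\<lambda>z. ((z - y) \<bullet> n) / norm (z - y)) \<longlongrightarrow> 0) (at y within frontier \<Omega>)"
    using assms by (simp add: outer_unit_normal_def)
  then show ?thesis
    by (simp add: has_derivative_within divide_inverse mult.commute inner_diff_left)
qed

context boundary_chart
begin

lemma p_in_ball: "p \<in> ball p r"
  using r_pos by simp

lemma continuous_F: "continuous_on (ball p r) F"
  by (meson F_deriv continuous_at_imp_continuous_on has_derivative_continuous)

lemma continuous_G: "continuous_on (ball p r) G"
  by (meson G_diff continuous_at_imp_continuous_on differentiable_imp_continuous_within)

lemma F_along:
  assumes "y \<in> ball p r"
  shows "((\<lambda>s. F (y + s *\<^sub>R w)) has_real_derivative (G y \<bullet> w)) (at 0)"
proof -
  have "((\<lambda>s. y + s *\<^sub>R w) has_derivative (\<lambda>s. s *\<^sub>R w)) (at (0::real))"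
    by (auto intro!: derivative_eq_intros)
  moreover have "(F has_derivative (\<lambda>v. G y \<bullet> v)) (at (y + 0 *\<^sub>R w))"
    using F_deriv[OF assms] by simp
  ultimately have "((\<lambda>s. F (y + s *\<^sub>R w)) has_derivative (\<lambda>s. G y \<bullet> (s *\<^sub>R w))) (at 0)"
    by (rule has_derivative_compose)
  then show ?thesis
    by (simp add: has_field_derivative_def mult_commute_abs)
qed

lemma G_inner_e:
  assumes "y \<in> ball p r"
  shows "G y \<bullet> e = 1"
proof -
  have "((\<lambda>s. F (y + s *\<^sub>R e)) has_real_derivative 1) (at 0)"
    unfolding F_shift by (auto intro!: derivative_eq_intros)
  then show ?thesis
    using F_along[OF assms] DERIV_unique by blast
qed

lemma G_nonzero: "y \<in> ball p r \<Longrightarrow> G y \<noteq> 0"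
  using G_inner_e by fastforce

lemma stays_in_ball:
  assumes "y \<in> ball p r"
  obtains d where "d > 0" "\<And>s. \<bar>s\<bar> < d \<Longrightarrow> y + s *\<^sub>R w \<in> ball p r"
proof -
  have "((\<lambda>s. y + s *\<^sub>R w) \<longlongrightarrow> y + 0 *\<^sub>R w) (nhds 0)"
    by (intro tendsto_intros filterlim_ident)
  then have "\<forall>\<^sub>F s in nhds 0. y + s *\<^sub>R w \<in> ball p r"
    using assms by (intro topological_tendstoD) auto
  then show thesis
    using that unfolding eventually_nhds_metric by (auto simp: dist_real_def)
qed

text \<open>A direction along which \<open>F\<close> decreases points into the domain.\<close>

lemma descent_in_domain:
  assumes y: "y \<in> ball p r" "F y \<le> 0" and w: "G y \<bullet> w < 0"
  obtains d where "d > 0" "\<And>s. 0 < s \<Longrightarrow> s \<le> d \<Longrightarrow> y + s *\<^sub>R w \<in> \<Omega>"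
proof -
  obtain d1 where d1: "d1 > 0" "\<And>s. 0 < s \<Longrightarrow> s < d1 \<Longrightarrow> F (y + s *\<^sub>R w) < F y"
    using DERIV_neg_dec_right[OF F_along[OF y(1)] w] by auto
  obtain d2 where d2: "d2 > 0" "\<And>s. \<bar>s\<bar> < d2 \<Longrightarrow> y + s *\<^sub>R w \<in> ball p r"
    using stays_in_ball[OF y(1)] by blast
  show thesis
  proof (rule that[of "min d1 d2 / 2"])
    show "y + s *\<^sub>R w \<in> \<Omega>" if "0 < s" "s \<le> min d1 d2 / 2" for s
      using that d1 d2(1) d2(2)[of s] y(2) domain_iff[of "y + s *\<^sub>R w"]
      by (smt (verit, best) field_sum_of_halves min_less_iff_conj)
  qed (use d1(1) d2(1) in auto)
qed

lemma closure_if_F_nonpos: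
  assumes y: "y \<in> ball p r" "F y \<le> 0"
  shows "y \<in> closure \<Omega>"
proof -
  obtain d where d: "d > 0" "\<And>s. 0 < s \<Longrightarrow> s \<le> d \<Longrightarrow> y + s *\<^sub>R (- e) \<in> \<Omega>"
    using descent_in_domain[OF y, of "- e"] G_inner_e[OF y(1)] by auto
  have "((\<lambda>s. y + s *\<^sub>R (- e)) \<longlongrightarrow> y + 0 *\<^sub>R (- e)) (at_right 0)"
    by (intro tendsto_intros)
  moreover have "\<forall>\<^sub>F s in at_right 0. y + s *\<^sub>R (- e) \<in> closure \<Omega>"
    using d closure_subset[of \<Omega>] unfolding eventually_at_right[OF d(1)] by (intro exI[of _ d]) auto
  ultimately show ?thesis
    using Lim_in_closed_set[of "closure \<Omega>" "\<lambda>s. y + s *\<^sub>R (- e)" "at_right 0"] by simp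
qed

lemma frontier_iff:
  assumes y: "y \<in> ball p r"
  shows "y \<in> frontier \<Omega> \<longleftrightarrow> F y = 0"
proof -
  have "y \<notin> closure \<Omega>" if "F y > 0"
  proof -
    have "open (F -` {0<..} \<inter> ball p r)"
      using continuous_F continuous_on_open_vimage[of "ball p r" F] by auto
    moreover have "F -` {0<..} \<inter> ball p r \<inter> \<Omega> = {}"
      using domain_iff by fastforce
    ultimately show ?thesis
      using that y open_Int_closure_eq_empty by blast
  qed
  moreover have "frontier \<Omega> = closure \<Omega> - \<Omega>"
    using open_domain by (simp add: frontier_def interior_open)
  ultimately show ?thesis
    using closure_if_F_nonpos[OF y] domain_iff[OF y] by (smt (verit) Diff_iff)
qed

lemma F_p: "F p = 0"
  using frontier_iff[OF p_in_ball] p_frontier by simp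

text \<open>The curve is the line through \<open>y\<close> in direction \<open>w\<close>, pushed back to the boundary along \<open>e\<close>;
  tangency makes the correction of second order.\<close>

lemma tangent_curve:
  assumes y: "y \<in> ball p r" "F y = 0" and w: "G y \<bullet> w = 0"
  obtains c d where "d > 0" "c 0 = y" "(c has_vector_derivative w) (at 0 within {0..d})"
    "\<And>s. s \<in> {0..d} \<Longrightarrow> c s \<in> frontier \<Omega>"
proof -
  define c where "c s = y + s *\<^sub>R w - F (y + s *\<^sub>R w) *\<^sub>R e" for s :: real
  have Fc: "F (c s) = 0" for s
    using F_shift[of "y + s *\<^sub>R w" "- F (y + s *\<^sub>R w)"] by (simp add: c_def)
  have c0: "c 0 = y"
    by (simp add: c_def y)
  have D: "(c has_vector_derivative w) (at 0)"
    unfolding c_def [abs_def]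
    using F_along[OF y(1), of w] w
    by (auto intro!: derivative_eq_intros simp: has_real_derivative_iff_has_vector_derivative)
  have "isCont c 0"
    using D has_vector_derivative_continuous by blast
  then have "\<forall>\<^sub>F s in nhds 0. c s \<in> ball p r"
    using y(1) c0 unfolding isCont_def tendsto_at_iff_tendsto_nhds
    by (intro topological_tendstoD[of c "c 0"]) auto
  then obtain d where d: "d > 0" "\<And>s. \<bar>s\<bar> < d \<Longrightarrow> c s \<in> ball p r"
    unfolding eventually_nhds_metric by (auto simp: dist_real_def)
  show thesis
  proof (rule that[of "d / 2" c])
    show "c s \<in> frontier \<Omega>" if "s \<in> {0..d / 2}" for s
      using frontier_iff[of "c s"] Fc d(1) d(2)[of s] that by auto
    show "(c has_vector_derivative w) (at 0 within {0..d / 2})"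
      using D by (rule has_vector_derivative_at_within)
  qed (use c0 d in auto)
qed

text \<open>Comparing derivatives along boundary curves makes a unit normal orthogonal to \<open>(G y)\<^sup>\<bottom>\<close>,
  hence a multiple of \<open>G y\<close>; a negative multiple would point into the domain.\<close>

lemma outer_unit_normal_eq:
  assumes y: "y \<in> ball p r" "F y = 0" and n: "outer_unit_normal \<Omega> y n"
  shows "n = sgn (G y)"
proof -
  have unit: "norm n = 1" and out: "\<forall>\<^sub>F s in at_right (0::real). y + s *\<^sub>R n \<notin> closure \<Omega>"
    using n by (auto simp: outer_unit_normal_def)
  have lin: "((\<lambda>z. z \<bullet> n) has_derivative (\<lambda>v. v \<bullet> n)) (at y within frontier \<Omega>)"
    by (auto intro!: derivative_eq_intros)
  have orth: "v \<bullet> n = 0" if v: "G y \<bullet> v = 0" for v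
  proof -
    obtain c d where "d > 0" "c 0 = y" "(c has_vector_derivative v) (at 0 within {0..d})"
      "\<And>s. s \<in> {0..d} \<Longrightarrow> c s \<in> frontier \<Omega>"
      using tangent_curve[OF y v] by blast
    then show ?thesis
      using has_derivative_unique_along_curve[OF lin outer_unit_normal_flat[OF n]] by blast
  qed
  define k where "k = (n \<bullet> G y) / (G y \<bullet> G y)"
  have GG: "G y \<bullet> G y > 0"
    using G_nonzero[OF y(1)] by simp
  have perp: "G y \<bullet> (n - k *\<^sub>R G y) = 0"
    using GG by (simp add: k_def inner_diff_right inner_commute)
  then have "(n - k *\<^sub>R G y) \<bullet> (n - k *\<^sub>R G y) = 0"
    using orth[OF perp] inner_diff_right[of "n - k *\<^sub>R G y" n "k *\<^sub>R G y"]
    by (simp add: inner_commute[of "n - k *\<^sub>R G y" "G y"])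
  then have nk: "n = k *\<^sub>R G y"
    by simp
  have "k \<ge> 0"
  proof (rule ccontr)
    assume "\<not> k \<ge> 0"
    then have "G y \<bullet> n < 0"
      using GG by (simp add: nk mult_neg_pos)
    then obtain d where d: "d > 0" "\<And>s. 0 < s \<Longrightarrow> s \<le> d \<Longrightarrow> y + s *\<^sub>R n \<in> \<Omega>"
      using descent_in_domain[OF y(1)] y(2) by auto
    then have "\<forall>\<^sub>F s in at_right 0. y + s *\<^sub>R n \<in> closure \<Omega>"
      using closure_subset[of \<Omega>] unfolding eventually_at_right[OF d(1)] by (intro exI[of _ d]) auto
    with out have "\<forall>\<^sub>F s in at_right (0::real). False"
      by eventually_elim auto
    then show False
      by simp
  qed
  moreover have "\<bar>k\<bar> * norm (G y) = 1"
    using unit nk by simp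
  ultimately show ?thesis
    using G_nonzero[OF y(1)] by (simp add: nk sgn_div_norm field_simps)
qed

text \<open>Rays in directions \<open>w\<close> with \<open>G p \<bullet> w < 0\<close> enter the domain, so the two derivatives agree on an
  open half-space, which spans.\<close>

lemma has_derivative_unique_within_closure:
  assumes A: "(f has_derivative A) (at p within closure \<Omega>)"
    and B: "(f has_derivative B) (at p within closure \<Omega>)"
  shows "A = B"
proof
  interpret A: bounded_linear A
    using A by (rule has_derivative_bounded_linear)
  interpret B: bounded_linear B
    using B by (rule has_derivative_bounded_linear)
  have half: "A w = B w" if w: "G p \<bullet> w < 0" for w
  proof -
    obtain d where d: "d > 0" "\<And>s. 0 < s \<Longrightarrow> s \<le> d \<Longrightarrow> p + s *\<^sub>R w \<in> \<Omega>"
      using descent_in_domain[OF p_in_ball _ w] F_p by auto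
    have "p + s *\<^sub>R w \<in> closure \<Omega>" if "s \<in> {0..d}" for s
    proof (cases "s = 0")
      case True
      then show ?thesis
        using p_frontier by (simp add: frontier_def)
    next
      case False
      then show ?thesis
        using d(2)[of s] that closure_subset by auto
    qed
    then show ?thesis
      using has_derivative_unique_along_ray[OF A B d(1)] by blast
  qed
  fix v
  \<comment> \<open>For this \<open>t\<close>, both \<open>v - t e\<close> and \<open>- e\<close> lie in the half-space, and \<open>v\<close> is a combination of them.\<close>
  define t where "t = \<bar>G p \<bullet> v\<bar> + 1"
  have Ge: "G p \<bullet> e = 1"
    using G_inner_e[OF p_in_ball] .
  have "A (v - t *\<^sub>R e) = B (v - t *\<^sub>R e)"
    by (rule half) (simp add: inner_diff_right Ge t_def)
  moreover have "A (- e) = B (- e)"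
    by (rule half) (simp add: Ge)
  ultimately show "A v = B v"
    by (simp add: A.diff B.diff A.scaleR B.scaleR A.neg B.neg)
qed

lemma dir_deriv_eq:
  assumes "(f has_derivative f') (at p within closure \<Omega>)"
  shows "dir_deriv \<Omega> f v p = f' v"
proof -
  have "(f has_derivative frechet_derivative f (at p within closure \<Omega>)) (at p within closure \<Omega>)"
    using assms by (auto simp: differentiable_def frechet_derivative_works[symmetric])
  then have "frechet_derivative f (at p within closure \<Omega>) = f'"
    using assms by (rule has_derivative_unique_within_closure)
  then show ?thesis
    by (simp add: dir_deriv_def)
qed

end

section \<open>The extended normal field\<close>

text \<open>In the proof, \<open>\<Phi> y\<close> lies over the boundary point \<open>\<pi> y\<close> at signed height \<open>F y\<close> in the normal
  direction, so that constancy along normals gives \<open>\<nu> (\<Phi> y) = \<nu> (\<pi> y)\<close>. The height \<open>F y\<close> can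
  serve as normal coordinate because its gradient is a nonzero normal, which makes the derivative
  of \<open>\<Phi>\<close> at \<open>p\<close> injective; by the open mapping theorem for maps differentiable at a single point, \<open>\<Phi>\<close>
  then reaches all points near \<open>p\<close> from arbitrarily small neighbourhoods of \<open>p\<close>.\<close>

lemma (in boundary_chart) extended_normal_differentiable:
  assumes \<nu>: "extended_normal \<Omega> \<nu>"
  shows "\<nu> differentiable (at p)" and "\<forall>\<^sub>F z in nhds p. norm (\<nu> z) = 1"
proof -
  obtain \<delta> where \<delta>: "\<delta> > 0"
    "\<And>x s. x \<in> frontier \<Omega> \<Longrightarrow> \<bar>s\<bar> < \<delta> \<Longrightarrow> \<nu> (x + s *\<^sub>R \<nu> x) = \<nu> x"
    and normal: "\<And>x. x \<in> frontier \<Omega> \<Longrightarrow> outer_unit_normal \<Omega> x (\<nu> x)"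
    using \<nu> unfolding extended_normal_def by blast
  have \<nu>_eq: "\<nu> x = sgn (G x)" if "x \<in> ball p r" "F x = 0" for x
    using that normal outer_unit_normal_eq frontier_iff by blast
  define \<pi> where "\<pi> y = y - F y *\<^sub>R e" for y
  define m where "m y = sgn (G (\<pi> y))" for y
  define \<Phi> where "\<Phi> y = \<pi> y + F y *\<^sub>R m y" for y
  have F\<pi>: "F (\<pi> y) = 0" for y
    using F_shift[of y "- F y"] by (simp add: \<pi>_def)
  have \<pi>p: "\<pi> p = p" and \<Phi>p: "\<Phi> p = p"
    by (auto simp: \<pi>_def \<Phi>_def F_p)
  define U where "U = \<pi> -` ball p r \<inter> ball p r"
  have cont_\<pi>: "continuous_on (ball p r) \<pi>"
    unfolding \<pi>_def [abs_def] by (intro continuous_intros continuous_F)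
  have U: "open U" "p \<in> U"
    using continuous_on_open_vimage[of "ball p r" \<pi>] cont_\<pi> \<pi>p p_in_ball by (auto simp: U_def)
  have "continuous_on U \<Phi>"
  proof -
    have \<pi>U: "continuous_on U \<pi>" and FU: "continuous_on U F"
      using cont_\<pi> continuous_F by (auto simp: U_def intro: continuous_on_subset)
    have "continuous_on U (\<lambda>y. G (\<pi> y))"
      by (rule continuous_on_compose2[OF continuous_G \<pi>U]) (auto simp: U_def)
    then have "continuous_on U m"
      unfolding m_def [abs_def] sgn_div_norm
      by (intro continuous_intros) (auto simp: U_def G_nonzero)
    then show ?thesis
      unfolding \<Phi>_def [abs_def] by (intro continuous_intros \<pi>U FU)
  qed

  have D\<pi>: "(\<pi> has_derivative (\<lambda>v. v - (G p \<bullet> v) *\<^sub>R e)) (at p)"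
    unfolding \<pi>_def [abs_def] by (auto intro!: derivative_eq_intros F_deriv p_in_ball)
  have "m differentiable (at p)"
  proof -
    have "(G \<circ> \<pi>) differentiable (at p)"
      using D\<pi> G_diff[OF p_in_ball] \<pi>p
      by (intro differentiable_chain_at) (auto simp: differentiable_def)
    then have G\<pi>: "(\<lambda>y. G (\<pi> y)) differentiable (at p)"
      by (simp add: o_def)
    have "(norm \<circ> (\<lambda>y. G (\<pi> y))) differentiable (at p)"
      using G\<pi> G_nonzero[OF p_in_ball] \<pi>p
      by (intro differentiable_chain_at differentiable_norm_at) auto
    then have "(\<lambda>y. inverse (norm (G (\<pi> y)))) differentiable (at p)"
      using G_nonzero[OF p_in_ball] \<pi>p by (intro differentiable_inverse) (auto simp: o_def)
    then show ?thesis
      unfolding m_def [abs_def] sgn_div_norm using G\<pi> by (rule differentiable_scaleR)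
  qed
  then obtain M where M: "(m has_derivative M) (at p)"
    by (auto simp: differentiable_def)
  define L where "L v = v - (G p \<bullet> v) *\<^sub>R e + (G p \<bullet> v) *\<^sub>R m p" for v
  have D\<Phi>: "(\<Phi> has_derivative L) (at p)"
    unfolding \<Phi>_def [abs_def] L_def [abs_def]
    by (auto intro!: derivative_eq_intros D\<pi> M F_deriv p_in_ball simp: F_p)

  have Gm: "G p \<bullet> m p = norm (G p)"
    using G_nonzero[OF p_in_ball]
    by (simp add: m_def \<pi>p sgn_div_norm dot_square_norm power2_eq_square)
  have "inj L"
  proof -
    interpret L: bounded_linear L
      using D\<Phi> by (rule has_derivative_bounded_linear)
    have "v = 0" if "L v = 0" for v
    proof -
      \<comment> \<open>Pairing \<open>L v\<close> with \<open>G p\<close> isolates \<open>G p \<bullet> v\<close>, because \<open>v - (G p \<bullet> v) e\<close> is tangent.\<close>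
      have "G p \<bullet> L v = (G p \<bullet> v) * norm (G p)"
        by (simp add: L_def inner_diff_right inner_add_right G_inner_e[OF p_in_ball] Gm)
      then have "G p \<bullet> v = 0"
        using that G_nonzero[OF p_in_ball] by simp
      then show ?thesis
        using that by (simp add: L_def)
    qed
    then show ?thesis
      using L.linear_axioms linear_injective_0 by blast
  qed
  moreover have "linear L"
    using D\<Phi> by (rule has_derivative_linear)
  ultimately obtain L' where L': "linear L'" "\<And>v. L' (L v) = v" "\<And>v. L (L' v) = v"
    using linear_injective_isomorphism by metis
  then have bL': "bounded_linear L'"
    by (simp add: linear_conv_bounded_linear)

  have near: "\<forall>\<^sub>F z in nhds (\<Phi> p). \<exists>y\<in>ball p d. \<Phi> y = z \<and> \<nu> z = m y" if d: "d > 0" for d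
  proof -
    define V where "V = {y \<in> ball p d \<inter> U. \<bar>F y\<bar> < \<delta>}"
    have "V = (\<lambda>y. \<bar>F y\<bar>) -` {..<\<delta>} \<inter> (ball p d \<inter> U)"
      by (auto simp: V_def)
    moreover have "continuous_on (ball p d \<inter> U) (\<lambda>y. \<bar>F y\<bar>)"
      using continuous_F by (intro continuous_intros continuous_on_subset[OF continuous_F])
        (auto simp: U_def)
    ultimately have "open V"
      using U(1) continuous_on_open_vimage[of "ball p d \<inter> U" "\<lambda>y. \<bar>F y\<bar>"] by (auto simp: open_Int)
    moreover have "p \<in> V"
      using d U \<delta>(1) by (simp add: V_def F_p)
    ultimately have "\<Phi> p \<in> interior (\<Phi> ` V)"
      using U \<open>continuous_on U \<Phi>\<close> D\<Phi> bL' L'(3)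
      by (intro sussmann_open_mapping[of U \<Phi> p L L' V])
        (auto simp: interior_open V_def fun_eq_iff)
    then have "\<forall>\<^sub>F z in nhds (\<Phi> p). z \<in> \<Phi> ` V"
      unfolding eventually_nhds using interior_subset open_interior by blast
    moreover have "\<nu> (\<Phi> y) = m y" if "y \<in> V" for y
    proof -
      have \<pi>y: "\<pi> y \<in> ball p r" "\<bar>F y\<bar> < \<delta>"
        using that by (auto simp: V_def U_def)
      then have "\<nu> (\<pi> y) = m y"
        by (simp add: \<nu>_eq F\<pi> m_def)
      then show ?thesis
        using \<delta>(2)[of "\<pi> y" "F y"] frontier_iff[OF \<pi>y(1)] F\<pi> \<pi>y(2) by (simp add: \<Phi>_def)
    qed
    ultimately show ?thesis
      by (auto elim!: eventually_mono simp: V_def)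
  qed

  have "\<nu> (\<Phi> p) = m p"
    using \<nu>_eq[OF p_in_ball F_p] by (simp add: \<Phi>p m_def \<pi>p)
  then have "(\<nu> has_derivative (M \<circ> L')) (at (\<Phi> p))"
    using near by (intro has_derivative_factor[OF D\<Phi> M bL' L'(2)])
  then show "\<nu> differentiable (at p)"
    by (auto simp: \<Phi>p differentiable_def)

  \<comment> \<open>Nearby values of \<open>\<nu>\<close> are values of \<open>m\<close>, which are unit vectors while \<open>\<pi>\<close> stays in the ball.\<close>
  obtain d where d: "d > 0" "ball p d \<subseteq> U"
    using U open_contains_ball by blast
  have "norm (m y) = 1" if "y \<in> ball p d" for y
  proof -
    have "\<pi> y \<in> ball p r"
      using d(2) that by (auto simp: U_def)
    then show ?thesis
      using G_nonzero by (simp add: m_def norm_sgn)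
  qed
  then show "\<forall>\<^sub>F z in nhds p. norm (\<nu> z) = 1"
    using near[OF d(1)] unfolding \<Phi>p by (auto elim!: eventually_mono)
qed

text \<open>This is the derivative of \<open>|\<nu>|\<^sup>2 = 1\<close>.\<close>

lemma unit_field_derivative_orthogonal:
  fixes \<nu> :: "'a::real_normed_vector \<Rightarrow> 'b::real_inner"
  assumes N: "(\<nu> has_derivative N) (at p)" and unit: "\<forall>\<^sub>F z in nhds p. norm (\<nu> z) = 1"
  shows "N v \<bullet> \<nu> p = 0"
proof -
  have "((\<lambda>z. \<nu> z \<bullet> \<nu> z) has_derivative (\<lambda>v. \<nu> p \<bullet> N v + N v \<bullet> \<nu> p)) (at p)"
    using N N by (rule has_derivative_inner)
  moreover have "((\<lambda>z. \<nu> z \<bullet> \<nu> z) has_derivative (\<lambda>v. 0)) (at p)"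
  proof (rule has_derivative_transform_eventually[OF has_derivative_const[of 1]])
    show "\<forall>\<^sub>F z in at p. 1 = \<nu> z \<bullet> \<nu> z"
      using unit unfolding eventually_at_filter
      by eventually_elim (simp add: dot_square_norm)
    show "1 = \<nu> p \<bullet> \<nu> p"
      using eventually_nhds_x_imp_x[OF unit] by (simp add: dot_square_norm)
  qed simp
  ultimately have "(\<lambda>v. \<nu> p \<bullet> N v + N v \<bullet> \<nu> p) = (\<lambda>v. 0)"
    by (rule has_derivative_unique)
  then have "\<nu> p \<bullet> N v + N v \<bullet> \<nu> p = 0"
    by meson
  then show ?thesis
    by (simp add: inner_commute)
qed

lemma extended_normal_derivative_normal:
  assumes N: "(\<nu> has_derivative N) (at p)" and \<nu>: "extended_normal \<Omega> \<nu>" and p: "p \<in> frontier \<Omega>"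
  shows "N (\<nu> p) = 0"
proof -
  obtain \<delta> where \<delta>: "\<delta> > 0" "\<And>s. \<bar>s\<bar> < \<delta> \<Longrightarrow> \<nu> (p + s *\<^sub>R \<nu> p) = \<nu> p"
    using \<nu> p unfolding extended_normal_def by blast
  define X where "X = (\<lambda>s. p + s *\<^sub>R \<nu> p) ` {0..\<delta> / 2}"
  have const: "\<nu> z = \<nu> p" if "z \<in> X" for z
    using that \<delta> by (auto simp: X_def)
  have "p \<in> X"
    using \<delta>(1) by (auto simp: X_def image_iff intro!: bexI[of _ 0])
  then have "(\<nu> has_derivative (\<lambda>v. 0)) (at p within X)"
    by (rule has_derivative_transform[of p X \<nu> "\<lambda>_. \<nu> p"]) (fact const, rule has_derivative_const)
  moreover have "(\<nu> has_derivative N) (at p within X)"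
    using N by (rule has_derivative_at_withinI)
  ultimately show ?thesis
    by (intro has_derivative_unique_along_ray[of \<nu> N p X "\<lambda>v. 0" "\<delta> / 2" "\<nu> p"])
      (use \<delta>(1) in \<open>auto simp: X_def\<close>)
qed

section \<open>Derivatives of the normal speed and the weights\<close>

text \<open>The tangential gradient is the tangential part of the full derivative: the outer normal is
  normal to the boundary to first order, so removing the normal part of the derivative changes it
  only by a function that vanishes to first order along the boundary.\<close>

lemma (in boundary_chart) tangential_gradient_inner:
  assumes A: "(f has_derivative A) (at p within closure \<Omega>)"
    and n: "outer_unit_normal \<Omega> p (\<nu> p)" and w: "w \<bullet> \<nu> p = 0"
  shows "w \<bullet> tangential_gradient \<Omega> \<nu> f p = A w"
proof -
  interpret A: bounded_linear A
    using A by (rule has_derivative_bounded_linear)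
  have unit: "norm (\<nu> p) = 1"
    using n by (simp add: outer_unit_normal_def)
  have \<nu>_eq: "\<nu> p = sgn (G p)"
    using outer_unit_normal_eq[OF p_in_ball F_p n] .
  have Af: "(f has_derivative A) (at p within frontier \<Omega>)"
    using A by (rule has_derivative_subset) (simp add: frontier_def)
  define a where "a = (\<Sum>b\<in>Basis. A b *\<^sub>R b)"
  have a: "a \<bullet> v = A v" for v
    by (simp add: a_def linear_functional_inner A.linear_axioms)
  define g where "g = a - (a \<bullet> \<nu> p) *\<^sub>R \<nu> p"
  have g\<nu>: "g \<bullet> \<nu> p = 0"
    using unit by (simp add: g_def inner_diff_left dot_square_norm)
  have "((\<lambda>z. (a \<bullet> \<nu> p) * (z \<bullet> \<nu> p)) has_derivative (\<lambda>v. (a \<bullet> \<nu> p) * (v \<bullet> \<nu> p)))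
      (at p within frontier \<Omega>)"
    by (intro has_derivative_mult_right has_derivative_inner_left has_derivative_ident)
  from has_derivative_diff[OF Af this]
  have "((\<lambda>z. f z - (a \<bullet> \<nu> p) * (z \<bullet> \<nu> p)) has_derivative (\<lambda>v. g \<bullet> v)) (at p within frontier \<Omega>)"
    by (simp add: g_def inner_diff_left a inner_commute[of "\<nu> p"])
  \<comment> \<open>Adding back the subtracted function changes nothing in the derivative: along the boundary
    it is flat at \<open>p\<close>.\<close>
  from has_derivative_add[OF this has_derivative_mult_right[OF outer_unit_normal_flat[OF n],
        of "a \<bullet> \<nu> p"]]
  have gf: "(f has_derivative (\<lambda>v. g \<bullet> v)) (at p within frontier \<Omega>)"
    by simp
  have uniq: "g' = g" if g': "g' \<bullet> \<nu> p = 0"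
    "(f has_derivative (\<lambda>v. g' \<bullet> v)) (at p within frontier \<Omega>)" for g'
  proof -
    have "(g' - g) \<bullet> \<nu> p = 0"
      using g'(1) g\<nu> by (simp add: inner_diff_left)
    then have tang: "G p \<bullet> (g' - g) = 0"
      using G_nonzero[OF p_in_ball] by (simp add: \<nu>_eq sgn_div_norm inner_commute)
    obtain c d where "d > 0" "c 0 = p" "(c has_vector_derivative (g' - g)) (at 0 within {0..d})"
      "\<And>s. s \<in> {0..d} \<Longrightarrow> c s \<in> frontier \<Omega>"
      using tangent_curve[OF p_in_ball F_p tang] by blast
    then have "g' \<bullet> (g' - g) = g \<bullet> (g' - g)"
      using has_derivative_unique_along_curve[OF g'(2) gf] by blast
    then have "(g' - g) \<bullet> (g' - g) = 0"
      by (simp add: inner_diff_left)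
    then show ?thesis
      by simp
  qed
  have "tangential_gradient \<Omega> \<nu> f p = g"
    unfolding tangential_gradient_def by (rule the_equality) (intro conjI g\<nu> gf, elim conjE uniq)
  then show ?thesis
    using w a[of w] by (simp add: g_def inner_diff_right inner_commute[of w a])
qed

text \<open>Only tangential components survive in \<open>S \<bullet> N S\<close>, and this is where the second fundamental
  form comes from.\<close>

lemma second_fundamental_form_tangential_part:
  assumes N: "(\<nu> has_derivative N) (at p)" and normal: "N (\<nu> p) = 0"
    and orth: "\<And>v. N v \<bullet> \<nu> p = 0"
  shows "S p \<bullet> N (S p) =
    - second_fundamental_form \<nu> p (tangential_part \<nu> S p) (tangential_part \<nu> S p)"
proof -
  interpret N: bounded_linear N
    using N by (rule has_derivative_bounded_linear)
  have "frechet_derivative \<nu> (at p) = N"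
    using frechet_derivative_at[OF N] by simp
  moreover have "N (tangential_part \<nu> S p) = N (S p)"
    by (simp add: tangential_part_def N.diff N.scaleR normal)
  ultimately show ?thesis
    using orth[of "S p"]
    by (simp add: second_fundamental_form_def tangential_part_def inner_diff_right inner_commute)
qed

theorem theorem29:
  fixes \<Omega> :: "(real^'n) set" and T :: "real \<Rightarrow> real^'n \<Rightarrow> real^'n" and \<epsilon> :: real
    and S R \<nu> :: "real^'n \<Rightarrow> real^'n"
  assumes "CARD('n) \<ge> 2"
    and "bounded \<Omega>" and "C21_domain \<Omega>"
    and "deformation_family \<Omega> \<epsilon> T" and "twice_differentiable_family \<Omega> \<epsilon> T"
    and "velocity_field \<Omega> T S" and "acceleration_field \<Omega> T R"
    and "extended_normal \<Omega> \<nu>"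
  shows "let \<delta>\<rho> = normal_part \<nu> S; \<delta>2\<rho> = normal_part \<nu> R; S\<^sub>\<tau> = tangential_part \<nu> S in
    \<forall>x\<in>frontier \<Omega>. S differentiable (at x within closure \<Omega>) \<longrightarrow>
      chi_weight \<Omega> \<nu> S R x =
        \<delta>2\<rho> x - 2 * (S\<^sub>\<tau> x \<bullet> tangential_gradient \<Omega> \<nu> \<delta>\<rho> x)
        - second_fundamental_form \<nu> x (S\<^sub>\<tau> x) (S\<^sub>\<tau> x) - (\<delta>\<rho> x)\<^sup>2 * divergence \<nu> x \<and>
      sigma_weight \<Omega> \<nu> S R x =
        \<delta>2\<rho> x - 2 * (S\<^sub>\<tau> x \<bullet> tangential_gradient \<Omega> \<nu> \<delta>\<rho> x)
        - second_fundamental_form \<nu> x (S\<^sub>\<tau> x) (S\<^sub>\<tau> x)"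
  unfolding Let_def
proof (intro ballI impI)
  fix x assume x: "x \<in> frontier \<Omega>" and "S differentiable (at x within closure \<Omega>)"
  then obtain D where D: "(S has_derivative D) (at x within closure \<Omega>)"
    by (auto simp: differentiable_def)
  obtain r e F G where "boundary_chart \<Omega> x r e F G"
    using C21_domain_chart[OF assms(3) x] .
  then interpret boundary_chart \<Omega> x r e F G .
  obtain N where N: "(\<nu> has_derivative N) (at x)"
    using extended_normal_differentiable(1)[OF assms(8)] by (auto simp: differentiable_def)
  have orth: "N v \<bullet> \<nu> x = 0" for v
    using unit_field_derivative_orthogonal[OF N extended_normal_differentiable(2)[OF assms(8)]] .
  have n: "outer_unit_normal \<Omega> x (\<nu> x)"
    using assms(8) x by (simp add: extended_normal_def)
  then have unit: "\<nu> x \<bullet> \<nu> x = 1"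
    by (simp add: outer_unit_normal_def dot_square_norm)

  let ?\<delta>\<rho> = "normal_part \<nu> S" and ?S\<tau> = "tangential_part \<nu> S x"
  let ?B = "second_fundamental_form \<nu> x ?S\<tau> ?S\<tau>"
  define A where "A v = S x \<bullet> N v + D v \<bullet> \<nu> x" for v
  have A: "(?\<delta>\<rho> has_derivative A) (at x within closure \<Omega>)"
    unfolding normal_part_def [abs_def] A_def [abs_def]
    using D has_derivative_at_withinI[OF N] by (rule has_derivative_inner)
  then have A2: "((\<lambda>y. (?\<delta>\<rho> y)\<^sup>2) has_derivative (\<lambda>v. 2 * ?\<delta>\<rho> x * A v)) (at x within closure \<Omega>)"
    by (auto intro!: derivative_eq_intros)
  interpret A: bounded_linear A
    using A by (rule has_derivative_bounded_linear)

  have DS: "D (S x) \<bullet> \<nu> x = A (S x) + ?B"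
    using second_fundamental_form_tangential_part[OF N
        extended_normal_derivative_normal[OF N assms(8) x] orth, of S]
    by (simp add: A_def)
  have "?S\<tau> \<bullet> \<nu> x = 0"
    by (simp add: tangential_part_def normal_part_def inner_diff_left unit)
  then have grad: "?S\<tau> \<bullet> tangential_gradient \<Omega> \<nu> ?\<delta>\<rho> x = A ?S\<tau>"
    using tangential_gradient_inner[where \<nu> = \<nu>, OF A n] by blast
  have split: "A (S x) = A ?S\<tau> + ?\<delta>\<rho> x * A (\<nu> x)"
    by (simp add: tangential_part_def A.diff A.scaleR)
  show "chi_weight \<Omega> \<nu> S R x = normal_part \<nu> R x - 2 * (?S\<tau> \<bullet> tangential_gradient \<Omega> \<nu> ?\<delta>\<rho> x)
        - ?B - (?\<delta>\<rho> x)\<^sup>2 * divergence \<nu> x \<and>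
      sigma_weight \<Omega> \<nu> S R x = normal_part \<nu> R x - 2 * (?S\<tau> \<bullet> tangential_gradient \<Omega> \<nu> ?\<delta>\<rho> x) - ?B"
    unfolding chi_weight_def sigma_weight_def Let_def grad dir_deriv_eq[OF D] dir_deriv_eq[OF A] dir_deriv_eq[OF A2]
    by (simp add: inner_diff_left DS split normal_part_def[of \<nu> R])
qed

end
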